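(* Let $X$ be a topological Markov shift with countable state space $S$ and transition matrix $A$, let $k\ge1$ be an integer, and let $\varphi\in F^{k+1}(X)$ be real-valued. Assume that $\varphi$ is summable. Then $$P(\varphi)=\sup\{P(\varphi|_{X_M}) : M\in M[S,A]\ \text{is irreducible}\}.$$
   Context: $S$ is a countable set and $A=(A(ij))_{i,j\in S}$ a zero-one matrix; $X=\{\omega\in S^{\mathbb{Z}_{\ge0}}:A(\omega_n\omega_{n+1})=1\ \forall n\ge0\}$, with shift $(\sigma\omega)_n=\omega_{n+1}$. For $w\in S^n$, $[w]=\{\omega\in X:\omega_0\cdots\omega_{n-1}=w\}$. Fix $\theta\in(0,1)$. $X$ carries the metric $d_\theta(\omega,\upsilon)=\theta^{\min\{n\ge0:\omega_n\ne\upsilon_n\}}$ for $\omega\neq\upsilon$. For a function $f$ on $X$ put $\operatorname{var}_nf=\sup\{|f(\omega)-f(\upsilon)|:\omega_i=\upsilon_i,\ 0\le i\le n-1\}$ and $[f]_k=\sup\{\operatorname{var}_nf/\theta^n:n\ge k\}$. $F^k(X)$ is the set of continuous functions $f$ on $X$ with $[f]_k<\infty$. A function $\varphi:X\to\mathbb{R}$ is summable if $\sum_{s\in S:[s]\ne\emptyset}\exp(\sup_{\omega\in[s]}\varphi(\omega))<\infty$. The topological pressure is $P(\varphi)=\lim_{n\to\infty}\frac1n\log\sum_{w\in S^n:[w]\neq\emptyset}\exp(\sup_{\omega\in[w]}\sum_{i=0}^{n-1}\varphi(\sigma^i\omega))$, with $\log0=-\infty$; for a subsystem it is computed with the subsystem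 in place of $X$. $M[S,A]$ is the set of zero-one matrices $M:S_0\times S_0\to\{0,1\}$ indexed by some nonempty subset $S_0\subset S$ with $M(ij)\le A(ij)$ for all $i,j\in S_0$; for such $M$, $X_M=\{\omega\in S_0^{\mathbb{Z}_{\ge0}}:M(\omega_n\omega_{n+1})=1\ \forall n\ge0\}$. $M$ is irreducible if for all $a,b\in S_0$ there are $n\ge2$ and a word $w=w_1\cdots w_n\in S_0^n$ with $w_1=a$, $w_n=b$ and $M(w_iw_{i+1})=1$ for $1\le i<n$. Convention: $\sup\emptyset=-\infty$. *)

theory Defs
  imports "HOL-Analysis.Analysis"
begin

fun eexp :: "ereal \<Rightarrow> ennreal" where
  "eexp (ereal r) = ennreal (exp r)"
| "eexp PInfty = \<infinity>"
| "eexp MInfty = 0"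

definition elog :: "ennreal \<Rightarrow> ereal" where
  "elog x = (if x = 0 then -\<infinity> else if x = \<infinity> then \<infinity> else ereal (ln (enn2real x)))"

text \<open>A matrix indexed by \<^term>\<open>S\<close> is a function on the whole type; only its entries at
  \<^term>\<open>S \<times> S\<close> are ever used.\<close>

definition zero_one_matrix :: "'s set \<Rightarrow> ('s \<Rightarrow> 's \<Rightarrow> nat) \<Rightarrow> bool" where
  "zero_one_matrix S A \<longleftrightarrow> (\<forall>i\<in>S. \<forall>j\<in>S. A i j \<in> {0, 1})"

definition markov_shift :: "'s set \<Rightarrow> ('s \<Rightarrow> 's \<Rightarrow> nat) \<Rightarrow> (nat \<Rightarrow> 's) set" where
  "markov_shift S A = {\<omega>. (\<forall>n. \<omega> n \<in> S) \<and> (\<forall>n. A (\<omega> n) (\<omega> (Suc n)) = 1)}"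

definition shift :: "(nat \<Rightarrow> 's) \<Rightarrow> nat \<Rightarrow> 's" where
  "shift \<omega> = (\<lambda>n. \<omega> (Suc n))"

definition words :: "'s set \<Rightarrow> nat \<Rightarrow> 's list set" where
  "words S n = {w. length w = n \<and> set w \<subseteq> S}"

definition cylinder :: "'s set \<Rightarrow> ('s \<Rightarrow> 's \<Rightarrow> nat) \<Rightarrow> 's list \<Rightarrow> (nat \<Rightarrow> 's) set" where
  "cylinder S A w = {\<omega> \<in> markov_shift S A. \<forall>i<length w. \<omega> i = w ! i}"

definition d_theta :: "real \<Rightarrow> (nat \<Rightarrow> 's) \<Rightarrow> (nat \<Rightarrow> 's) \<Rightarrow> real" where
  "d_theta \<theta> \<omega> \<upsilon> = (if \<omega> = \<upsilon> then 0 else \<theta> ^ (LEAST n. \<omega> n \<noteq> \<upsilon> n))"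

lemma Metric_space_d_theta:
  assumes "0 < \<theta>" "\<theta> < 1"
  shows "Metric_space X (d_theta \<theta>)"
proof
  fix x y z :: "nat \<Rightarrow> 'a"
  show "0 \<le> d_theta \<theta> x y"
    using assms by (simp add: d_theta_def)
  have "(LEAST n. x n \<noteq> y n) = (LEAST n. y n \<noteq> x n)"
    by (rule arg_cong[where f = Least]) auto
  then show "d_theta \<theta> x y = d_theta \<theta> y x"
    by (auto simp: d_theta_def)
  show "d_theta \<theta> x y = 0 \<longleftrightarrow> x = y"
    using assms by (simp add: d_theta_def)
  show "d_theta \<theta> x z \<le> d_theta \<theta> x y + d_theta \<theta> y z"
  proof (cases "x = y \<or> y = z \<or> x = z")
    case True
    then show ?thesis using assms by (auto simp: d_theta_def)
  next
    case False
    define a b c where "a = (LEAST n. x n \<noteq> y n)" and "b = (LEAST n. y n \<noteq> z n)"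
      and "c = (LEAST n. x n \<noteq> z n)"
    have "\<exists>n. x n \<noteq> z n" using False by auto
    then have "x c \<noteq> z c" unfolding c_def by (rule LeastI_ex)
    then have "x c \<noteq> y c \<or> y c \<noteq> z c" by auto
    then have "a \<le> c \<or> b \<le> c"
      unfolding a_def b_def by (auto intro: Least_le)
    then have "\<theta> ^ c \<le> \<theta> ^ a \<or> \<theta> ^ c \<le> \<theta> ^ b"
      using assms by (auto intro: power_decreasing)
    moreover have "0 \<le> \<theta> ^ a" "0 \<le> \<theta> ^ b" using assms by auto
    ultimately have "\<theta> ^ c \<le> \<theta> ^ a + \<theta> ^ b" by linarith
    then show ?thesis
      using False by (simp add: d_theta_def a_def b_def c_def)
  qed
qed

text \<open>Suprema are taken in \<^typ>\<open>ereal\<close>, so they may be infinite, and the supremum of the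
  empty set is \<^term>\<open>-\<infinity> :: ereal\<close>.\<close>

definition var :: "(nat \<Rightarrow> 's) set \<Rightarrow> nat \<Rightarrow> ((nat \<Rightarrow> 's) \<Rightarrow> 'b::real_normed_vector) \<Rightarrow> ereal" where
  "var X n f = Sup {ereal (norm (f \<omega> - f \<upsilon>)) | \<omega> \<upsilon>. \<omega> \<in> X \<and> \<upsilon> \<in> X \<and> (\<forall>i<n. \<omega> i = \<upsilon> i)}"

definition holder_seminorm ::
    "real \<Rightarrow> (nat \<Rightarrow> 's) set \<Rightarrow> nat \<Rightarrow> ((nat \<Rightarrow> 's) \<Rightarrow> 'b::real_normed_vector) \<Rightarrow> ereal" where
  "holder_seminorm \<theta> X k f = (SUP n\<in>{k..}. var X n f / ereal (\<theta> ^ n))"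

definition F_space ::
    "real \<Rightarrow> (nat \<Rightarrow> 's) set \<Rightarrow> nat \<Rightarrow> ((nat \<Rightarrow> 's) \<Rightarrow> 'b::real_normed_vector) set" where
  "F_space \<theta> X k =
     {f. continuous_map (Metric_space.mtopology X (d_theta \<theta>)) euclidean f
         \<and> holder_seminorm \<theta> X k f < \<infinity>}"

definition summable_potential ::
    "'s set \<Rightarrow> ('s \<Rightarrow> 's \<Rightarrow> nat) \<Rightarrow> ((nat \<Rightarrow> 's) \<Rightarrow> real) \<Rightarrow> bool" where
  "summable_potential S A \<phi> \<longleftrightarrow>
     (\<Sum>\<^sub>\<infinity>s\<in>{s\<in>S. cylinder S A [s] \<noteq> {}}. eexp (SUP \<omega>\<in>cylinder S A [s]. ereal (\<phi> \<omega>))) < \<infinity>"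

definition birkhoff_sum :: "nat \<Rightarrow> ((nat \<Rightarrow> 's) \<Rightarrow> real) \<Rightarrow> (nat \<Rightarrow> 's) \<Rightarrow> real" where
  "birkhoff_sum n \<phi> \<omega> = (\<Sum>i<n. \<phi> ((shift ^^ i) \<omega>))"

definition partition_sum ::
    "'s set \<Rightarrow> ('s \<Rightarrow> 's \<Rightarrow> nat) \<Rightarrow> ((nat \<Rightarrow> 's) \<Rightarrow> real) \<Rightarrow> nat \<Rightarrow> ennreal" where
  "partition_sum S A \<phi> n =
     (\<Sum>\<^sub>\<infinity>w\<in>{w\<in>words S n. cylinder S A w \<noteq> {}}.
        eexp (SUP \<omega>\<in>cylinder S A w. ereal (birkhoff_sum n \<phi> \<omega>)))"

text \<open>Only the values of \<^term>\<open>\<phi>\<close> on \<^term>\<open>markov_shift S A\<close> enter, so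
  \<open>pressure S\<^sub>0 M \<phi>\<close> is the pressure of the restriction of \<^term>\<open>\<phi>\<close> to
  \<open>markov_shift S\<^sub>0 M\<close>.\<close>

definition pressure :: "'s set \<Rightarrow> ('s \<Rightarrow> 's \<Rightarrow> nat) \<Rightarrow> ((nat \<Rightarrow> 's) \<Rightarrow> real) \<Rightarrow> ereal" where
  "pressure S A \<phi> = lim (\<lambda>n. ereal (1 / real n) * elog (partition_sum S A \<phi> n))"

definition submatrices ::
    "'s set \<Rightarrow> ('s \<Rightarrow> 's \<Rightarrow> nat) \<Rightarrow> ('s set \<times> ('s \<Rightarrow> 's \<Rightarrow> nat)) set" where
  "submatrices S A =
     {(S\<^sub>0, M). S\<^sub>0 \<noteq> {} \<and> S\<^sub>0 \<subseteq> S \<and> zero_one_matrix S\<^sub>0 M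
        \<and> (\<forall>i\<in>S\<^sub>0. \<forall>j\<in>S\<^sub>0. M i j \<le> A i j)}"

definition irreducible_matrix :: "'s set \<Rightarrow> ('s \<Rightarrow> 's \<Rightarrow> nat) \<Rightarrow> bool" where
  "irreducible_matrix S\<^sub>0 M \<longleftrightarrow>
     (\<forall>a\<in>S\<^sub>0. \<forall>b\<in>S\<^sub>0. \<exists>n\<ge>2. \<exists>w\<in>words S\<^sub>0 n. w ! 0 = a \<and> w ! (n - 1) = b
        \<and> (\<forall>i. Suc i < n \<longrightarrow> M (w ! i) (w ! Suc i) = 1))"

end

theory Submission
  imports Defs
begin

text \<open>
  Restricting to a subsystem shrinks the set of admissible words and the cylinders over which
  suprema are taken, so the supremum on the right is at most the pressure of the full shift.
  The content is the reverse inequality: every real \<open>t\<close> above all pressures of irreducible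
  subsystems bounds the exponential growth rate of the partition sums \<open>Z n\<close> of the full shift.

  The letters are cut into communicating classes of the transition graph.  A path that leaves a
  class never returns to it, so in an admissible word the letters of one class form a single
  block.  A class \<open>C\<close> containing a loop is an irreducible subsystem (take \<open>A\<close> itself as the matrix
  on \<open>C\<close>); a class without a loop is a single letter that occurs at most once in a word.
  Summability supplies a finite set \<open>F\<close> of letters such that the letters outside \<open>F\<close> have
  total weight at most \<open>exp t\<close>; words avoiding \<open>F\<close> then contribute at most \<open>exp (t n)\<close>.  The
  letters of \<open>F\<close> are put back one at a time.  Putting back \<open>a\<close> means that a word splits as
  \<open>v\<^sub>0 u v\<^sub>1\<close> with \<open>u\<close> in the class of \<open>a\<close> and \<open>v\<^sub>0\<close>, \<open>v\<^sub>1\<close> avoiding that class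
  (\<open>word_split_comm_class\<close>).  There are only polynomially many positions for the two cuts and
  weights are submultiplicative, so the growth rate rises above \<open>t\<close> by an arbitrarily small
  amount (\<open>word_sum_growth_restore_class\<close>).  As \<open>F\<close> is finite, this happens finitely often.

  It remains to compare words in \<open>C\<close> weighted by suprema over cylinders of the full shift with
  the partition sums of the subsystem on \<open>C\<close>.  The difficulty is that the variation of \<open>\<phi>\<close> over
  cylinders of length at most \<open>k\<close> may be infinite, so the last \<open>k\<close> terms of a Birkhoff sum
  cannot be compared at all.  They are instead split off: the first \<open>m\<close> terms along a word of
  length \<open>m + k\<close> have uniformly bounded distortion, and the last \<open>k\<close> letters contribute, by
  submultiplicativity, a factor whose sum over all words of length \<open>k\<close> is finite
  (\<open>comm_class_word_sum_le\<close>).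
\<close>

section \<open>Sums of extended nonnegative reals\<close>

lemma infsum_ennreal_le_iff:
  fixes f :: "'a \<Rightarrow> ennreal"
  shows "infsum f A \<le> c \<longleftrightarrow> (\<forall>F. finite F \<and> F \<subseteq> A \<longrightarrow> sum f F \<le> c)"
  by (subst nonneg_infsum_complete) (auto simp: SUP_le_iff)

lemma sum_le_infsum_ennreal:
  fixes f :: "'a \<Rightarrow> ennreal"
  assumes "finite F" "F \<subseteq> A"
  shows "sum f F \<le> infsum f A"
  using assms infsum_ennreal_le_iff[of f A "infsum f A"] by auto

lemma infsum_ennreal_mono:
  fixes f g :: "'a \<Rightarrow> ennreal"
  assumes "\<And>x. x \<in> A \<Longrightarrow> f x \<noteq> 0 \<Longrightarrow> x \<in> B \<and> f x \<le> g x"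
  shows "infsum f A \<le> infsum g B"
proof (rule infsum_mono_neutral)
  show "f summable_on A" "g summable_on B" by (simp_all add: nonneg_summable_on_complete)
  show "f x \<le> g x" if "x \<in> A \<inter> B" for x using assms[of x] that by (cases "f x = 0") auto
  show "f x \<le> 0" if "x \<in> A - B" for x using assms[of x] that by (cases "f x = 0") auto
qed simp

lemma infsum_ennreal_Un_le:
  fixes f :: "'a \<Rightarrow> ennreal"
  shows "infsum f (A \<union> B) \<le> infsum f A + infsum f B"
proof -
  have "infsum f (A \<union> B) = infsum f (A \<union> (B - A))" by simp
  also have "\<dots> = infsum f A + infsum f (B - A)"
    by (rule infsum_Un_disjoint) (auto simp: nonneg_summable_on_complete)
  also have "\<dots> \<le> infsum f A + infsum f B"
    by (intro add_left_mono infsum_ennreal_mono) auto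
  finally show ?thesis .
qed

lemma infsum_ennreal_UN_le:
  fixes f :: "'a \<Rightarrow> ennreal"
  assumes "finite I"
  shows "infsum f (\<Union>i\<in>I. B i) \<le> (\<Sum>i\<in>I. infsum f (B i))"
  using assms
proof (induction I)
  case empty
  then show ?case by simp
next
  case (insert i I)
  have "infsum f (\<Union>j\<in>insert i I. B j) \<le> infsum f (B i) + infsum f (\<Union>j\<in>I. B j)"
    using infsum_ennreal_Un_le[of f "B i" "\<Union>j\<in>I. B j"] by simp
  also have "\<dots> \<le> infsum f (B i) + (\<Sum>j\<in>I. infsum f (B j))"
    using insert.IH by (rule add_left_mono)
  finally show ?case using insert.hyps by simp
qed

text \<open>Each word may arise from several pairs \<open>(u, v)\<close>; only the upper bound is true in general.  The
  factor \<open>c\<close> leaves room for a distortion constant.\<close>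

lemma infsum_ennreal_append_le:
  fixes f g h :: "'a list \<Rightarrow> ennreal"
  assumes "\<And>u v. u \<in> U \<Longrightarrow> v \<in> V \<Longrightarrow> h (u @ v) \<le> c * f u * g v"
  shows "infsum h {u @ v | u v. u \<in> U \<and> v \<in> V} \<le> c * infsum f U * infsum g V"
  unfolding infsum_ennreal_le_iff
proof (intro allI impI, elim conjE)
  fix G assume G: "finite G" "G \<subseteq> {u @ v | u v. u \<in> U \<and> v \<in> V}"
  have "{u @ v | u v. u \<in> U \<and> v \<in> V} = (\<lambda>(u, v). u @ v) ` (U \<times> V)" by auto
  with G obtain P where P: "finite P" "P \<subseteq> U \<times> V" "G = (\<lambda>(u, v). u @ v) ` P"
    using finite_subset_image[OF G(1), of "\<lambda>(u, v). u @ v" "U \<times> V"] by auto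
  define U' V' where "U' = fst ` P" and "V' = snd ` P"
  have fin: "finite U'" "finite V'" and sub: "U' \<subseteq> U" "V' \<subseteq> V" "P \<subseteq> U' \<times> V'"
    using P unfolding U'_def V'_def by force+
  have "sum h G \<le> (\<Sum>p\<in>P. h (fst p @ snd p))"
    unfolding P(3) using sum_image_le[OF P(1), of h "\<lambda>(u, v). u @ v"]
    by (simp add: case_prod_beta o_def)
  also have "\<dots> \<le> (\<Sum>p\<in>U' \<times> V'. h (fst p @ snd p))"
    by (rule sum_mono2) (use fin sub in auto)
  also have "\<dots> \<le> (\<Sum>p\<in>U' \<times> V'. c * f (fst p) * g (snd p))"
    by (rule sum_mono) (use sub in \<open>auto intro!: assms\<close>)
  also have "\<dots> = (\<Sum>u\<in>U'. \<Sum>v\<in>V'. c * f u * g v)"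
    by (simp add: sum.cartesian_product case_prod_beta)
  also have "\<dots> = c * sum f U' * sum g V'"
    by (simp only: mult.assoc sum_product) (simp only: sum_distrib_left)
  also have "\<dots> \<le> c * infsum f U * infsum g V"
    by (intro mult_mono sum_le_infsum_ennreal fin sub) auto
  finally show "sum h G \<le> c * infsum f U * infsum g V" .
qed

lemma infsum_ennreal_small_tail:
  fixes f :: "'a \<Rightarrow> ennreal"
  assumes "infsum f A < \<infinity>" "0 < e"
  obtains F where "finite F" "F \<subseteq> A" "infsum f (A - F) \<le> e"
proof -
  have "\<exists>F. finite F \<and> F \<subseteq> A \<and> infsum f A \<le> sum f F + e"
  proof (cases "infsum f A = 0")
    case True
    then show ?thesis by (intro exI[of _ "{}"]) auto
  next
    case False
    have "infsum f A - e < infsum f A"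
      using assms False by (intro ennreal_between) (auto simp: zero_less_iff_neq_zero)
    then have "\<not> (\<forall>F. finite F \<and> F \<subseteq> A \<longrightarrow> sum f F \<le> infsum f A - e)"
      using infsum_ennreal_le_iff[of f A "infsum f A - e"] by auto
    then obtain F where "finite F" "F \<subseteq> A" "infsum f A - e < sum f F" by force
    then show ?thesis
      using ennreal_minus_le_iff[of "infsum f A" e "sum f F"] by (auto simp: add.commute intro!: exI[of _ F])
  qed
  then obtain F where F: "finite F" "F \<subseteq> A" "infsum f A \<le> sum f F + e" by auto
  have "infsum f (F \<union> (A - F)) = infsum f F + infsum f (A - F)"
    by (rule infsum_Un_disjoint) (auto simp: nonneg_summable_on_complete)
  moreover have "F \<union> (A - F) = A" using F by auto
  ultimately have "infsum f A = sum f F + infsum f (A - F)" using F by simp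
  moreover have "sum f F < \<infinity>"
    using sum_le_infsum_ennreal[OF F(1,2)] assms(1) by (rule le_less_trans)
  ultimately have "infsum f (A - F) \<le> e"
    using F(3) by (auto simp: ennreal_add_left_cancel_le)
  with F that show thesis by blast
qed

section \<open>Exponential growth and subadditivity\<close>

lemma eexp_mono: "x \<le> y \<Longrightarrow> eexp x \<le> eexp y"
  using eexp.simps(2,3)[unfolded PInfty_eq_infinity MInfty_eq_minfinity]
  by (cases x; cases y) auto

lemma eexp_SUP_le:
  assumes "\<And>x. x \<in> X \<Longrightarrow> ennreal (exp (h x)) \<le> c"
  shows "eexp (SUP x\<in>X. ereal (h x)) \<le> c"
proof (cases "X = {} \<or> c = \<infinity>")
  case True
  have "eexp bot = 0"
    using eexp.simps(3) by (simp add: bot_ereal_def)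
  with True show ?thesis by auto
next
  case False
  then obtain x where "x \<in> X" by auto
  from False obtain r where r: "c = ennreal r" "0 \<le> r" by (cases c) auto
  have le: "exp (h y) \<le> r" if "y \<in> X" for y
    using assms[OF that] r by (simp add: ennreal_le_iff)
  then have "0 < r" using \<open>x \<in> X\<close> less_le_trans exp_gt_zero by blast
  have "(SUP x\<in>X. ereal (h x)) \<le> ereal (ln r)"
    by (intro SUP_least) (use le \<open>0 < r\<close> in \<open>simp add: ln_ge_iff\<close>)
  then have "eexp (SUP x\<in>X. ereal (h x)) \<le> eexp (ereal (ln r))"
    by (rule eexp_mono)
  then show ?thesis using r \<open>0 < r\<close> by simp
qed

lemma exp_le_eexp_SUP:
  assumes "x \<in> X"
  shows "ennreal (exp (h x)) \<le> eexp (SUP x\<in>X. ereal (h x))"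
proof -
  have "ereal (h x) \<le> (SUP x\<in>X. ereal (h x))" using assms by (intro SUP_upper)
  from eexp_mono[OF this] show ?thesis by simp
qed

lemma mean_elog_le_iff:
  assumes "n > 0"
  shows "ereal (1 / real n) * elog z \<le> ereal t \<longleftrightarrow> z \<le> ennreal (exp (t * real n))"
proof (cases "z = 0 \<or> z = \<infinity>")
  case True
  then show ?thesis using assms by (auto simp: elog_def top_unique)
next
  case False
  then obtain r where r: "z = ennreal r" "0 < r"
    by (cases z) (auto simp: ennreal_eq_0_iff not_le)
  then have "elog z = ereal (ln r)" by (auto simp: elog_def ennreal_eq_0_iff)
  then have "ereal (1 / real n) * elog z \<le> ereal t \<longleftrightarrow> ln r \<le> t * real n"
    using assms by (simp add: field_simps)
  also have "\<dots> \<longleftrightarrow> r \<le> exp (t * real n)"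
    using r by (metis exp_le_cancel_iff exp_ln)
  finally show ?thesis using r by (simp add: ennreal_le_iff)
qed

text \<open>The single constant \<open>D\<close> serves all \<open>n\<close>, short blocks included: unlike an inequality between
  limits, such bounds can be multiplied along a word whose blocks have arbitrary lengths.\<close>

definition growth_bounded :: "(nat \<Rightarrow> ennreal) \<Rightarrow> real \<Rightarrow> bool" where
  "growth_bounded Z t \<longleftrightarrow> (\<exists>D>0. \<forall>n. Z n \<le> ennreal (D * exp (t * real n)))"

lemma growth_boundedI:
  assumes "\<And>n. Z n \<le> ennreal (D * exp (t * real n))"
  shows "growth_bounded Z t"
proof -
  have "Z n \<le> ennreal (max D 1 * exp (t * real n))" for n
    by (rule order_trans[OF assms]) (intro ennreal_leI mult_right_mono; simp)
  then show ?thesis unfolding growth_bounded_def by (intro exI[of _ "max D 1"]) auto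
qed

lemma growth_bounded_mono:
  assumes "growth_bounded Z t" "\<And>n. Z' n \<le> Z n" "t \<le> s"
  shows "growth_bounded Z' s"
proof -
  obtain D where D: "D > 0" "\<And>n. Z n \<le> ennreal (D * exp (t * real n))"
    using assms(1) unfolding growth_bounded_def by auto
  show ?thesis
  proof (rule growth_boundedI)
    fix n
    have "D * exp (t * real n) \<le> D * exp (s * real n)"
      using D assms(3) by (intro mult_left_mono) (auto intro: mult_right_mono)
    then have "ennreal (D * exp (t * real n)) \<le> ennreal (D * exp (s * real n))"
      by (rule ennreal_leI)
    with assms(2)[of n] D(2)[of n] show "Z' n \<le> ennreal (D * exp (s * real n))"
      by (meson order_trans)
  qed
qed

text \<open>Finitely many values of \<open>Z\<close> can be absorbed into the constant.\<close>

lemma growth_bounded_offset: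
  assumes "\<And>n. Z (n + k) \<le> ennreal (D * exp (t * real n))" "\<And>n. n < k \<Longrightarrow> Z n < \<infinity>"
    and "0 \<le> D"
  shows "growth_bounded Z t"
proof (rule growth_boundedI)
  fix n
  define E where "E = (\<Sum>j<k. enn2real (Z j) * exp (- (t * real j)))"
  have E: "0 \<le> E" unfolding E_def by (intro sum_nonneg) auto
  show "Z n \<le> ennreal ((D * exp (- (t * real k)) + E) * exp (t * real n))"
  proof (cases "n < k")
    case True
    have "enn2real (Z n) * exp (- (t * real n)) \<le> E"
      unfolding E_def using True by (intro member_le_sum) auto
    then have "enn2real (Z n) * exp (- (t * real n)) \<le> D * exp (- (t * real k)) + E"
      using assms(3) by (simp add: add_increasing)
    then have "enn2real (Z n) \<le> (D * exp (- (t * real k)) + E) * exp (t * real n)"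
      by (simp add: exp_minus field_simps)
    then have "ennreal (enn2real (Z n)) \<le> ennreal ((D * exp (- (t * real k)) + E) * exp (t * real n))"
      by (rule ennreal_leI)
    then show ?thesis using assms(2)[OF True] by (simp add: less_top)
  next
    case False
    then obtain m where m: "n = m + k" using le_Suc_ex[of k n] by (auto simp: add.commute)
    have "D * exp (t * real m) = D * exp (- (t * real k)) * exp (t * real n)"
      by (simp add: m algebra_simps flip: exp_add)
    also have "\<dots> \<le> (D * exp (- (t * real k)) + E) * exp (t * real n)"
      using E by (intro mult_right_mono) auto
    finally show ?thesis using assms(1)[of m] unfolding m using ennreal_leI order_trans by blast
  qed
qed

text \<open>The constant costs \<open>ln D / n\<close> in the exponent, which vanishes in the limit.\<close>

lemma growth_bounded_limsup_le:
  assumes "growth_bounded Z t"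
  shows "limsup (\<lambda>n. ereal (1 / real n) * elog (Z n)) \<le> ereal t"
proof (rule dense_ge)
  fix x assume "ereal t < x"
  obtain D where D: "D > 0" "\<And>n. Z n \<le> ennreal (D * exp (t * real n))"
    using assms unfolding growth_bounded_def by auto
  obtain s where s: "t < s" "ereal s \<le> x"
    using ereal_dense2[OF \<open>ereal t < x\<close>] by auto
  have "eventually (\<lambda>n. ereal (1 / real n) * elog (Z n) \<le> ereal s) sequentially"
  proof (rule eventually_sequentiallyI[of "Suc (nat \<lceil>ln D / (s - t)\<rceil>)"])
    fix n assume n: "Suc (nat \<lceil>ln D / (s - t)\<rceil>) \<le> n"
    then have "ln D / (s - t) \<le> real n" by linarith
    then have "ln D \<le> (s - t) * real n" using s(1) by (simp add: field_simps)
    then have "exp (ln D + t * real n) \<le> exp (s * real n)" by (simp add: algebra_simps)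
    then have "D * exp (t * real n) \<le> exp (s * real n)" using D(1) by (simp add: exp_add)
    then have "Z n \<le> ennreal (exp (s * real n))" using D(2)[of n] ennreal_leI order_trans by blast
    then show "ereal (1 / real n) * elog (Z n) \<le> ereal s"
      using n by (subst mean_elog_le_iff) auto
  qed
  then have "limsup (\<lambda>n. ereal (1 / real n) * elog (Z n)) \<le> ereal s" by (rule Limsup_bounded)
  then show "limsup (\<lambda>n. ereal (1 / real n) * elog (Z n)) \<le> x" using s(2) by (rule order_trans)
qed

lemma submultiplicative_power_le:
  fixes Z :: "nat \<Rightarrow> ennreal"
  assumes sub: "\<And>m n. Z (m + n) \<le> Z m * Z n" and "Z 0 \<le> 1"
  shows "Z (m * q) \<le> Z m ^ q"
proof (induction q)
  case 0
  then show ?case using assms by simp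
next
  case (Suc q)
  have "Z (m * Suc q) \<le> Z m * Z (m * q)" using sub[of m "m * q"] by simp
  also have "\<dots> \<le> Z m * Z m ^ q" using Suc.IH by (rule mult_left_mono) simp
  finally show ?case by simp
qed

text \<open>Fekete's argument: writing \<open>n = m q + r\<close> with \<open>r < m\<close>, a single good value
  \<open>Z m\<close> controls all \<open>Z n\<close>.\<close>

lemma submultiplicative_growth_bounded:
  fixes Z :: "nat \<Rightarrow> ennreal"
  assumes sub: "\<And>m n. Z (m + n) \<le> Z m * Z n" and Z0: "Z 0 \<le> 1" and Z1: "Z 1 < \<infinity>"
    and m: "m > 0" "Z m \<le> ennreal (exp (t * real m))"
  shows "growth_bounded Z t"
proof -
  obtain z where z: "Z 1 = ennreal z" "0 \<le> z" using Z1 by (cases "Z 1") auto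
  define D where "D = (\<Sum>r<m. z ^ r * exp (- (t * real r)))"
  show ?thesis
  proof (rule growth_boundedI)
    fix n
    define q r where "q = n div m" and "r = n mod m"
    have n: "n = m * q + r" and r: "r < m" using m by (auto simp: q_def r_def)
    have "Z n \<le> Z (m * q) * Z (1 * r)" using sub[of "m * q" r] n by simp
    also have "\<dots> \<le> Z m ^ q * Z 1 ^ r"
      by (intro mult_mono submultiplicative_power_le sub Z0) auto
    also have "\<dots> \<le> ennreal (exp (t * real m)) ^ q * ennreal z ^ r"
      using m z by (intro mult_mono power_mono) auto
    also have "\<dots> = ennreal (exp (t * real m) ^ q * z ^ r)"
      using z by (simp add: ennreal_power ennreal_mult)
    also have "exp (t * real m) ^ q = exp (- (t * real r)) * exp (t * real n)"
      unfolding n by (simp add: algebra_simps flip: exp_of_nat_mult exp_add)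
    also have "exp (- (t * real r)) * exp (t * real n) * z ^ r
        = z ^ r * exp (- (t * real r)) * exp (t * real n)"
      by simp
    also have "ennreal \<dots> \<le> ennreal (D * exp (t * real n))"
      unfolding D_def using r z by (intro ennreal_leI mult_right_mono member_le_sum) auto
    finally show "Z n \<le> ennreal (D * exp (t * real n))" .
  qed
qed

text \<open>Fekete's lemma in the form in which it is applied.  It covers sequences that vanish from
  some point on, where the limit is \<open>-\<infinity>\<close>.\<close>

lemma submultiplicative_growth_rate:
  fixes Z :: "nat \<Rightarrow> ennreal"
  assumes sub: "\<And>m n. Z (m + n) \<le> Z m * Z n" and Z0: "Z 0 \<le> 1" and Z1: "Z 1 < \<infinity>"
  defines "L \<equiv> lim (\<lambda>n. ereal (1 / real n) * elog (Z n))"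
  shows "L < ereal t \<Longrightarrow> growth_bounded Z t"
    and "growth_bounded Z t \<Longrightarrow> L \<le> ereal t"
proof -
  define a where "a = (\<lambda>n. ereal (1 / real n) * elog (Z n))"
  \<comment> \<open>As usual for subadditive sequences, the limit is the infimum.\<close>
  define l where "l = (INF n\<in>{1..}. a n)"
  have *: "growth_bounded Z s" if "l < ereal s" for s
  proof -
    obtain m where "m \<ge> 1" "a m < ereal s" using \<open>l < ereal s\<close> unfolding l_def INF_less_iff by auto
    then show ?thesis
      using mean_elog_le_iff[of m "Z m" s] unfolding a_def
      by (intro submultiplicative_growth_bounded[OF sub Z0 Z1, of m]) auto
  qed
  have "limsup a \<le> l"
  proof (rule dense_ge)
    fix x assume "l < x"
    then obtain s where "l < ereal s" "ereal s < x" using ereal_dense2 by blast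
    then show "limsup a \<le> x"
      using growth_bounded_limsup_le[OF *[of s]] unfolding a_def by (meson less_imp_le order_trans)
  qed
  moreover have "l \<le> liminf a"
    by (rule Liminf_bounded, rule eventually_sequentiallyI[of 1])
       (auto simp: l_def intro!: INF_lower)
  moreover have "liminf a \<le> limsup a" by (rule Liminf_le_Limsup) simp
  ultimately have eq: "liminf a = l" "limsup a = l" by auto
  then have "a \<longlonglongrightarrow> l" by (intro Liminf_eq_Limsup) auto
  then have L: "L = l" unfolding L_def a_def[symmetric] by (rule limI)
  show "L < ereal t \<Longrightarrow> growth_bounded Z t" unfolding L by (rule *)
  show "growth_bounded Z t \<Longrightarrow> L \<le> ereal t"
    unfolding L eq(2)[symmetric] a_def by (rule growth_bounded_limsup_le)
qed

section \<open>Weights of words\<close>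

definition word_weight ::
    "'s set \<Rightarrow> ('s \<Rightarrow> 's \<Rightarrow> nat) \<Rightarrow> ((nat \<Rightarrow> 's) \<Rightarrow> real) \<Rightarrow> 's list \<Rightarrow> ennreal" where
  "word_weight S A \<phi> w =
     eexp (SUP \<omega>\<in>cylinder S A w. ereal (birkhoff_sum (length w) \<phi> \<omega>))"

text \<open>The letters are restricted to \<open>T\<close>, but the cylinders stay those of the shift on \<open>S\<close>:
  removing letters does not change the weight of the remaining words.\<close>

definition word_sum ::
    "'s set \<Rightarrow> ('s \<Rightarrow> 's \<Rightarrow> nat) \<Rightarrow> ((nat \<Rightarrow> 's) \<Rightarrow> real) \<Rightarrow> 's set \<Rightarrow> nat \<Rightarrow> ennreal" where
  "word_sum S A \<phi> T n = infsum (word_weight S A \<phi>) (words T n)"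

lemma funpow_shift: "(shift ^^ i) \<omega> = (\<lambda>n. \<omega> (n + i))"
  by (induction i) (auto simp: shift_def)

lemma birkhoff_sum_add:
  "birkhoff_sum (m + n) \<phi> \<omega> = birkhoff_sum m \<phi> \<omega> + birkhoff_sum n \<phi> ((shift ^^ m) \<omega>)"
  by (induction n) (auto simp: birkhoff_sum_def funpow_shift add.commute add.left_commute)

lemma cylinder_append:
  assumes "\<omega> \<in> cylinder S A (u @ v)"
  shows "\<omega> \<in> cylinder S A u" "(shift ^^ length u) \<omega> \<in> cylinder S A v"
proof -
  have X: "\<omega> \<in> markov_shift S A" and eq: "\<And>i. i < length u + length v \<Longrightarrow> \<omega> i = (u @ v) ! i"
    using assms by (auto simp: cylinder_def)
  have "\<omega> i = u ! i" if "i < length u" for i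
    using eq[of i] that by (simp add: nth_append)
  then show "\<omega> \<in> cylinder S A u" using X by (auto simp: cylinder_def)
  have "\<omega> (i + length u) = v ! i" if "i < length v" for i
    using eq[of "i + length u"] that by (simp add: nth_append)
  then show "(shift ^^ length u) \<omega> \<in> cylinder S A v"
    using X by (auto simp: cylinder_def markov_shift_def funpow_shift)
qed

lemma word_weight_leI:
  assumes "\<And>\<omega>. \<omega> \<in> cylinder S A w \<Longrightarrow> ennreal (exp (birkhoff_sum (length w) \<phi> \<omega>)) \<le> c"
  shows "word_weight S A \<phi> w \<le> c"
  unfolding word_weight_def by (rule eexp_SUP_le) (rule assms)

lemma exp_birkhoff_le_word_weight:
  assumes "\<omega> \<in> cylinder S A w"
  shows "ennreal (exp (birkhoff_sum (length w) \<phi> \<omega>)) \<le> word_weight S A \<phi> w"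
  unfolding word_weight_def using assms by (rule exp_le_eexp_SUP)

lemma word_weight_empty_cylinder: "cylinder S A w = {} \<Longrightarrow> word_weight S A \<phi> w = 0"
  using word_weight_leI[of S A w \<phi> 0] by simp

lemma word_weight_append: "word_weight S A \<phi> (u @ v) \<le> word_weight S A \<phi> u * word_weight S A \<phi> v"
proof (rule word_weight_leI)
  fix \<omega> assume \<omega>: "\<omega> \<in> cylinder S A (u @ v)"
  have "ennreal (exp (birkhoff_sum (length (u @ v)) \<phi> \<omega>)) =
      ennreal (exp (birkhoff_sum (length u) \<phi> \<omega>)) *
      ennreal (exp (birkhoff_sum (length v) \<phi> ((shift ^^ length u) \<omega>)))"
    by (simp add: birkhoff_sum_add exp_add ennreal_mult)
  also have "\<dots> \<le> word_weight S A \<phi> u * word_weight S A \<phi> v"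
    by (intro mult_mono exp_birkhoff_le_word_weight cylinder_append[OF \<omega>]) auto
  finally show "ennreal (exp (birkhoff_sum (length (u @ v)) \<phi> \<omega>)) \<le>
      word_weight S A \<phi> u * word_weight S A \<phi> v" .
qed

lemma words_add: "words T (m + n) = {u @ v | u v. u \<in> words T m \<and> v \<in> words T n}"
proof (intro equalityI subsetI)
  fix w assume "w \<in> words T (m + n)"
  then have "take m w \<in> words T m" "drop m w \<in> words T n"
    using set_take_subset[of m w] set_drop_subset[of m w] by (auto simp: words_def)
  then show "w \<in> {u @ v | u v. u \<in> words T m \<and> v \<in> words T n}"
    unfolding mem_Collect_eq by (intro exI[of _ "take m w"] exI[of _ "drop m w"]) simp
qed (auto simp: words_def)

text \<open>Words with empty cylinder have weight \<open>0\<close>, as the supremum over the empty set is \<open>-\<infinity>\<close>.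
  Admissibility can therefore be dropped from the index set.\<close>

lemma partition_sum_eq_word_sum: "partition_sum S A \<phi> n = word_sum S A \<phi> S n"
proof -
  have "partition_sum S A \<phi> n = infsum (word_weight S A \<phi>) {w \<in> words S n. cylinder S A w \<noteq> {}}"
    unfolding partition_sum_def
    by (rule infsum_cong) (auto simp: word_weight_def words_def)
  also have "\<dots> = word_sum S A \<phi> S n"
    unfolding word_sum_def
    by (rule antisym; rule infsum_ennreal_mono) (auto simp: word_weight_empty_cylinder)
  finally show ?thesis .
qed

lemma word_sum_mono: "T \<subseteq> T' \<Longrightarrow> word_sum S A \<phi> T n \<le> word_sum S A \<phi> T' n"
  unfolding word_sum_def by (rule infsum_ennreal_mono) (auto simp: words_def)

lemma word_sum_add: "word_sum S A \<phi> T (m + n) \<le> word_sum S A \<phi> T m * word_sum S A \<phi> T n"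
  unfolding word_sum_def words_add
  using infsum_ennreal_append_le[of "words T m" "words T n" "word_weight S A \<phi>" 1
      "word_weight S A \<phi>" "word_weight S A \<phi>"]
  by (simp add: word_weight_append)

lemma word_sum_0: "word_sum S A \<phi> T 0 \<le> 1"
proof -
  have "words T 0 = {[]}" by (auto simp: words_def)
  moreover have "word_weight S A \<phi> [] \<le> 1"
    by (rule word_weight_leI) (simp add: birkhoff_sum_def)
  ultimately show ?thesis unfolding word_sum_def by simp
qed

lemma word_sum_power_le: "word_sum S A \<phi> T n \<le> word_sum S A \<phi> T 1 ^ n"
  using submultiplicative_power_le[of "word_sum S A \<phi> T" 1 n, OF word_sum_add word_sum_0] by simp

lemma words_1: "words T 1 = (\<lambda>s. [s]) ` T"
  by (auto simp: words_def length_Suc_conv)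

lemma summable_potential_iff: "summable_potential S A \<phi> \<longleftrightarrow> word_sum S A \<phi> S 1 < \<infinity>"
proof -
  have "word_sum S A \<phi> S 1 = infsum (\<lambda>s. word_weight S A \<phi> [s]) S"
    unfolding word_sum_def words_1 by (subst infsum_reindex) (auto simp: inj_on_def o_def)
  also have "\<dots> = infsum (\<lambda>s. word_weight S A \<phi> [s]) {s \<in> S. cylinder S A [s] \<noteq> {}}"
    by (rule antisym; rule infsum_ennreal_mono) (auto simp: word_weight_empty_cylinder)
  finally show ?thesis
    by (simp add: summable_potential_def word_weight_def birkhoff_sum_def)
qed

lemma pressure_growth:
  assumes "summable_potential S A \<phi>"
  shows "pressure S A \<phi> < ereal t \<Longrightarrow> growth_bounded (word_sum S A \<phi> S) t"
    and "growth_bounded (word_sum S A \<phi> S) t \<Longrightarrow> pressure S A \<phi> \<le> ereal t"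
  using submultiplicative_growth_rate[of "word_sum S A \<phi> S" t, OF word_sum_add word_sum_0]
    assms unfolding pressure_def partition_sum_eq_word_sum summable_potential_iff by blast+

lemma subsystem_cylinder:
  assumes "zero_one_matrix S A" "(S\<^sub>0, M) \<in> submatrices S A"
  shows "cylinder S\<^sub>0 M w \<subseteq> cylinder S A w"
proof -
  have "A i j = 1" if "i \<in> S\<^sub>0" "j \<in> S\<^sub>0" "M i j = 1" for i j
  proof -
    have "S\<^sub>0 \<subseteq> S" "\<forall>i\<in>S\<^sub>0. \<forall>j\<in>S\<^sub>0. M i j \<le> A i j"
      using assms(2) by (simp_all add: submatrices_def)
    then have "i \<in> S" "j \<in> S" "M i j \<le> A i j" using that by blast+
    moreover from this have "A i j \<in> {0, 1}" using assms(1) by (simp add: zero_one_matrix_def)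
    ultimately show ?thesis using that by auto
  qed
  then show ?thesis using assms(2) by (auto simp: cylinder_def markov_shift_def submatrices_def)
qed

lemma subsystem_word_sum_le:
  assumes "zero_one_matrix S A" "(S\<^sub>0, M) \<in> submatrices S A"
  shows "word_sum S\<^sub>0 M \<phi> S\<^sub>0 n \<le> word_sum S A \<phi> S n"
proof -
  have "word_weight S\<^sub>0 M \<phi> w \<le> word_weight S A \<phi> w" for w
    using subsystem_cylinder[OF assms]
    by (intro word_weight_leI exp_birkhoff_le_word_weight) auto
  moreover have "S\<^sub>0 \<subseteq> S" using assms by (auto simp: submatrices_def)
  ultimately show ?thesis
    unfolding word_sum_def by (intro infsum_ennreal_mono) (auto simp: words_def)
qed

lemma subsystem_summable:
  assumes "zero_one_matrix S A" "(S\<^sub>0, M) \<in> submatrices S A" "summable_potential S A \<phi>"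
  shows "summable_potential S\<^sub>0 M \<phi>"
  using subsystem_word_sum_le[OF assms(1,2), of \<phi> 1] assms(3)
  unfolding summable_potential_iff by (rule le_less_trans)

lemma subsystem_pressure_le:
  assumes "zero_one_matrix S A" "(S\<^sub>0, M) \<in> submatrices S A" "summable_potential S A \<phi>"
  shows "pressure S\<^sub>0 M \<phi> \<le> pressure S A \<phi>"
proof (rule dense_ge)
  fix x assume "pressure S A \<phi> < x"
  then obtain t where t: "pressure S A \<phi> < ereal t" "ereal t < x" using ereal_dense2 by blast
  have "growth_bounded (word_sum S\<^sub>0 M \<phi> S\<^sub>0) t"
    by (rule growth_bounded_mono[OF pressure_growth(1)[OF assms(3) t(1)]
          subsystem_word_sum_le[OF assms(1,2)] order_refl])
  then have "pressure S\<^sub>0 M \<phi> \<le> ereal t"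
    by (rule pressure_growth(2)[OF subsystem_summable[OF assms]])
  then show "pressure S\<^sub>0 M \<phi> \<le> x" using t(2) by simp
qed

section \<open>Distortion\<close>

lemma F_space_variation:
  assumes "\<phi> \<in> F_space \<theta> X k" and \<theta>: "0 < \<theta>"
  obtains H where "0 \<le> H"
    and "\<And>n \<omega> \<upsilon>. k \<le> n \<Longrightarrow> \<omega> \<in> X \<Longrightarrow> \<upsilon> \<in> X \<Longrightarrow> (\<And>i. i < n \<Longrightarrow> \<omega> i = \<upsilon> i) \<Longrightarrow>
      norm (\<phi> \<omega> - \<phi> \<upsilon>) \<le> H * \<theta> ^ n"
proof
  define H where "H = max 0 (real_of_ereal (holder_seminorm \<theta> X k \<phi>))"
  show "0 \<le> H" by (simp add: H_def)
  fix n \<omega> \<upsilon>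
  assume n: "k \<le> n" and X: "\<omega> \<in> X" "\<upsilon> \<in> X" and eq: "\<And>i. i < n \<Longrightarrow> \<omega> i = \<upsilon> i"
  have pos: "0 < ereal (\<theta> ^ n)" using \<theta> by simp
  have "ereal (norm (\<phi> \<omega> - \<phi> \<upsilon>)) \<le> var X n \<phi>"
    unfolding var_def by (rule Sup_upper) (use X eq in blast)
  then have "ereal (norm (\<phi> \<omega> - \<phi> \<upsilon>)) / ereal (\<theta> ^ n) \<le> var X n \<phi> / ereal (\<theta> ^ n)"
    using pos by (intro ereal_divide_right_mono) auto
  also have "\<dots> \<le> holder_seminorm \<theta> X k \<phi>"
    unfolding holder_seminorm_def using n by (intro SUP_upper) auto
  finally have le: "ereal (norm (\<phi> \<omega> - \<phi> \<upsilon>) / \<theta> ^ n) \<le> holder_seminorm \<theta> X k \<phi>"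
    using \<theta> by simp
  moreover have "holder_seminorm \<theta> X k \<phi> < \<infinity>" using assms(1) by (simp add: F_space_def)
  ultimately have "norm (\<phi> \<omega> - \<phi> \<upsilon>) / \<theta> ^ n \<le> real_of_ereal (holder_seminorm \<theta> X k \<phi>)"
    by (cases "holder_seminorm \<theta> X k \<phi>") auto
  also have "\<dots> \<le> H" by (simp add: H_def)
  finally show "norm (\<phi> \<omega> - \<phi> \<upsilon>) \<le> H * \<theta> ^ n" using \<theta> by (simp add: divide_le_eq)
qed

text \<open>Agreement on \<open>k\<close> coordinates beyond the \<open>m\<close> summands makes every variation that enters one over
  at least \<open>k + 1\<close> coordinates, where it is finite and decays geometrically; hence the constant
  does not depend on \<open>m\<close>.\<close>

lemma birkhoff_distortion:
  fixes \<phi> :: "(nat \<Rightarrow> 's) \<Rightarrow> real"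
  assumes "\<phi> \<in> F_space \<theta> (markov_shift S A) (k + 1)" and \<theta>: "0 < \<theta>" "\<theta> < 1"
  obtains K where
    "\<And>m \<omega> \<upsilon>. \<omega> \<in> markov_shift S A \<Longrightarrow> \<upsilon> \<in> markov_shift S A \<Longrightarrow>
      (\<And>i. i < m + k \<Longrightarrow> \<omega> i = \<upsilon> i) \<Longrightarrow>
      birkhoff_sum m \<phi> \<omega> \<le> K + birkhoff_sum m \<phi> \<upsilon>"
proof -
  obtain H where H: "0 \<le> H"
    "\<And>n \<omega> \<upsilon>. k + 1 \<le> n \<Longrightarrow> \<omega> \<in> markov_shift S A \<Longrightarrow> \<upsilon> \<in> markov_shift S A \<Longrightarrow>
      (\<And>i. i < n \<Longrightarrow> \<omega> i = \<upsilon> i) \<Longrightarrow> norm (\<phi> \<omega> - \<phi> \<upsilon>) \<le> H * \<theta> ^ n"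
    using F_space_variation[OF assms(1) \<theta>(1)] by blast
  show ?thesis
  proof (rule that[of "H / (1 - \<theta>)"])
    fix m \<omega> \<upsilon>
    assume X: "\<omega> \<in> markov_shift S A" "\<upsilon> \<in> markov_shift S A"
      and eq: "\<And>i. i < m + k \<Longrightarrow> \<omega> i = \<upsilon> i"
    have shX: "(shift ^^ i) \<xi> \<in> markov_shift S A" if "\<xi> \<in> markov_shift S A" for i \<xi>
      using that by (auto simp: markov_shift_def funpow_shift)
    have "birkhoff_sum m \<phi> \<omega> - birkhoff_sum m \<phi> \<upsilon> =
        (\<Sum>i<m. \<phi> ((shift ^^ i) \<omega>) - \<phi> ((shift ^^ i) \<upsilon>))"
      by (simp add: birkhoff_sum_def sum_subtractf)
    also have "\<dots> \<le> (\<Sum>i<m. H * \<theta> ^ (m - Suc i))"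
    proof (rule sum_mono)
      fix i assume "i \<in> {..<m}"
      then have i: "i < m" by simp
      have "norm (\<phi> ((shift ^^ i) \<omega>) - \<phi> ((shift ^^ i) \<upsilon>)) \<le> H * \<theta> ^ (m + k - i)"
      proof (rule H(2)[OF _ shX[OF X(1)] shX[OF X(2)]])
        show "k + 1 \<le> m + k - i" using i by simp
        show "(shift ^^ i) \<omega> j = (shift ^^ i) \<upsilon> j" if "j < m + k - i" for j
          using eq[of "j + i"] that by (simp add: funpow_shift)
      qed
      also have "\<dots> \<le> H * \<theta> ^ (m - Suc i)"
        using H(1) \<theta> by (intro mult_left_mono power_decreasing) auto
      finally show "\<phi> ((shift ^^ i) \<omega>) - \<phi> ((shift ^^ i) \<upsilon>) \<le> H * \<theta> ^ (m - Suc i)" by simp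
    qed
    also have "\<dots> = H * (\<Sum>i<m. \<theta> ^ i)"
      by (simp add: sum.nat_diff_reindex[of "\<lambda>i. H * \<theta> ^ i"] sum_distrib_left)
    also have "\<dots> \<le> H * (1 / (1 - \<theta>))"
      using H(1) \<theta> by (intro mult_left_mono) (auto simp: sum_gp_strict intro!: divide_right_mono)
    finally show "birkhoff_sum m \<phi> \<omega> \<le> H / (1 - \<theta>) + birkhoff_sum m \<phi> \<upsilon>" by simp
  qed
qed

section \<open>Communicating classes\<close>

definition edges :: "'s set \<Rightarrow> ('s \<Rightarrow> 's \<Rightarrow> nat) \<Rightarrow> ('s \<times> 's) set" where
  "edges S A = {(i, j). i \<in> S \<and> j \<in> S \<and> A i j = 1}"

text \<open>The closure is reflexive, so that \<open>a\<close> belongs to its class even if no loop passes through it.\<close>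

definition comm_class :: "'s set \<Rightarrow> ('s \<Rightarrow> 's \<Rightarrow> nat) \<Rightarrow> 's \<Rightarrow> 's set" where
  "comm_class S A a = {b. (a, b) \<in> (edges S A)\<^sup>* \<and> (b, a) \<in> (edges S A)\<^sup>*}"

lemma comm_class_self: "a \<in> comm_class S A a"
  by (simp add: comm_class_def)

lemma comm_class_subset:
  assumes "a \<in> S"
  shows "comm_class S A a \<subseteq> S"
proof
  fix b assume "b \<in> comm_class S A a"
  then have "(a, b) \<in> (edges S A)\<^sup>*" by (simp add: comm_class_def)
  then show "b \<in> S" using assms by (cases rule: rtranclE) (auto simp: edges_def)
qed

lemma comm_class_convex:
  assumes "b \<in> comm_class S A a" "c \<in> comm_class S A a"
    and "(b, d) \<in> (edges S A)\<^sup>*" "(d, c) \<in> (edges S A)\<^sup>*"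
  shows "d \<in> comm_class S A a"
  using assms unfolding comm_class_def by (auto intro: rtrancl_trans)

lemma markov_shift_edge: "\<omega> \<in> markov_shift S A \<Longrightarrow> (\<omega> n, \<omega> (Suc n)) \<in> edges S A"
  by (simp add: markov_shift_def edges_def)

lemma markov_shift_path:
  assumes "\<omega> \<in> markov_shift S A" "i \<le> j"
  shows "(\<omega> i, \<omega> j) \<in> (edges S A)\<^sup>*"
  using assms(2)
proof (induction rule: dec_induct)
  case (step n)
  then show ?case using markov_shift_edge[OF assms(1)] by (auto intro: rtrancl_into_rtrancl)
qed simp

text \<open>By convexity of the class, a word that has left it cannot meet it again: cutting at the first
  entry into \<open>C\<close> and at the following exit exhausts all letters from \<open>C\<close>.\<close>

lemma word_split_comm_class:
  fixes a :: 's
  assumes w: "w \<in> words T n" and ne: "cylinder S A w \<noteq> {}"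
  defines "C \<equiv> comm_class S A a"
  obtains v\<^sub>0 u v\<^sub>1 where "w = v\<^sub>0 @ u @ v\<^sub>1" "set v\<^sub>0 \<subseteq> T - C" "set u \<subseteq> C" "set v\<^sub>1 \<subseteq> T - C"
proof -
  from ne obtain \<omega> where \<omega>: "\<omega> \<in> markov_shift S A" "\<And>i. i < length w \<Longrightarrow> \<omega> i = w ! i"
    by (auto simp: cylinder_def)
  define v\<^sub>0 r where "v\<^sub>0 = takeWhile (\<lambda>s. s \<notin> C) w" and "r = dropWhile (\<lambda>s. s \<notin> C) w"
  define u v\<^sub>1 where "u = takeWhile (\<lambda>s. s \<in> C) r" and "v\<^sub>1 = dropWhile (\<lambda>s. s \<in> C) r"
  have w_eq: "w = v\<^sub>0 @ u @ v\<^sub>1" by (simp add: v\<^sub>0_def r_def u_def v\<^sub>1_def)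
  have v\<^sub>0: "set v\<^sub>0 \<inter> C = {}" unfolding v\<^sub>0_def by (auto dest: set_takeWhileD)
  have u: "set u \<subseteq> C" unfolding u_def by (auto dest: set_takeWhileD)
  have v\<^sub>1: "set v\<^sub>1 \<inter> C = {}"
  proof (rule ccontr)
    assume "set v\<^sub>1 \<inter> C \<noteq> {}"
    then obtain j where j: "j < length v\<^sub>1" "v\<^sub>1 ! j \<in> C" by (auto simp: in_set_conv_nth)
    then have "v\<^sub>1 \<noteq> []" by auto
    then have hd: "hd v\<^sub>1 \<notin> C" unfolding v\<^sub>1_def by (rule hd_dropWhile)
    have "r \<noteq> []" using \<open>v\<^sub>1 \<noteq> []\<close> unfolding v\<^sub>1_def by auto
    then have "hd r \<in> C" unfolding r_def using hd_dropWhile by blast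
    then have "u \<noteq> []" unfolding u_def using \<open>r \<noteq> []\<close> by (cases r) auto
    have len: "length w = length v\<^sub>0 + length u + length v\<^sub>1" using w_eq by simp
    have "\<omega> (length v\<^sub>0) = hd u"
      using \<omega>(2)[of "length v\<^sub>0"] len \<open>u \<noteq> []\<close> w_eq by (simp add: nth_append hd_conv_nth)
    then have 1: "\<omega> (length v\<^sub>0) \<in> C" using u \<open>u \<noteq> []\<close> by auto
    have 2: "\<omega> (length v\<^sub>0 + length u) = hd v\<^sub>1"
      using \<omega>(2)[of "length v\<^sub>0 + length u"] len \<open>v\<^sub>1 \<noteq> []\<close> w_eq
      by (simp add: nth_append hd_conv_nth)
    have 3: "\<omega> (length v\<^sub>0 + length u + j) = v\<^sub>1 ! j"
      using \<omega>(2)[of "length v\<^sub>0 + length u + j"] len j w_eq by (simp add: nth_append)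
    have in_C: "\<omega> (length v\<^sub>0 + length u + j) \<in> C" using 3 j(2) by simp
    have "\<omega> (length v\<^sub>0 + length u) \<in> C"
      unfolding C_def
      by (rule comm_class_convex[of "\<omega> (length v\<^sub>0)" _ _ _ "\<omega> (length v\<^sub>0 + length u + j)"])
         (use 1 in_C in \<open>simp_all add: C_def markov_shift_path[OF \<omega>(1)]\<close>)
    then show False using hd 2 by simp
  qed
  have "set w \<subseteq> T" using w by (simp add: words_def)
  then have "set v\<^sub>0 \<subseteq> T - C" "set v\<^sub>1 \<subseteq> T - C" using v\<^sub>0 v\<^sub>1 w_eq by auto
  then show thesis using that[OF w_eq] u by blast
qed

text \<open>Here \<open>i\<close> and \<open>j\<close> are the lengths of the first block and of the block inside the class.\<close>

lemma word_sum_split_comm_class: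
  fixes \<phi> :: "(nat \<Rightarrow> 's) \<Rightarrow> real" and S :: "'s set" and A :: "'s \<Rightarrow> 's \<Rightarrow> nat" and a :: 's
  defines "C \<equiv> comm_class S A a"
  shows "word_sum S A \<phi> T n \<le> (\<Sum>(i, j)\<in>{(i, j). i + j \<le> n}.
    word_sum S A \<phi> (T - C) i * (word_sum S A \<phi> C j * word_sum S A \<phi> (T - C) (n - i - j)))"
proof -
  let ?I = "{(i, j). i + j \<le> n} :: (nat \<times> nat) set"
  let ?g = "word_weight S A \<phi>"
  define U where "U = (\<lambda>i j. {u @ v | u v. u \<in> words C j \<and> v \<in> words (T - C) (n - i - j)})"
  define B where "B = (\<lambda>i j. {v @ u | v u. v \<in> words (T - C) i \<and> u \<in> U i j})"
  have "?I \<subseteq> {..n} \<times> {..n}" by auto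
  then have fin: "finite ?I" by (rule finite_subset) simp
  have cover: "w \<in> (\<Union>p\<in>?I. B (fst p) (snd p))" if w: "w \<in> words T n" "?g w \<noteq> 0" for w
  proof -
    have "cylinder S A w \<noteq> {}" using w(2) word_weight_empty_cylinder by blast
    then obtain v\<^sub>0 u v\<^sub>1 where *: "w = v\<^sub>0 @ u @ v\<^sub>1"
      "set v\<^sub>0 \<subseteq> T - C" "set u \<subseteq> C" "set v\<^sub>1 \<subseteq> T - C"
      unfolding C_def by (rule word_split_comm_class[OF w(1)])
    have len: "length v\<^sub>0 + length u + length v\<^sub>1 = n" using w(1) *(1) by (simp add: words_def)
    have "u @ v\<^sub>1 \<in> U (length v\<^sub>0) (length u)"
      unfolding U_def mem_Collect_eq
      by (intro exI[of _ u] exI[of _ v\<^sub>1]) (use * len in \<open>auto simp: words_def\<close>)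
    then have "w \<in> B (length v\<^sub>0) (length u)"
      unfolding B_def mem_Collect_eq
      by (intro exI[of _ v\<^sub>0] exI[of _ "u @ v\<^sub>1"]) (use * in \<open>auto simp: words_def\<close>)
    moreover have "(length v\<^sub>0, length u) \<in> ?I" using len by simp
    ultimately show ?thesis by force
  qed
  have U: "infsum ?g (U i j) \<le> word_sum S A \<phi> C j * word_sum S A \<phi> (T - C) (n - i - j)" for i j
    unfolding U_def word_sum_def
    using infsum_ennreal_append_le[of _ _ ?g 1 ?g ?g, simplified, OF word_weight_append] .
  have B: "infsum ?g (B i j) \<le> word_sum S A \<phi> (T - C) i *
      (word_sum S A \<phi> C j * word_sum S A \<phi> (T - C) (n - i - j))" for i j
  proof -
    have "infsum ?g (B i j) \<le> infsum ?g (words (T - C) i) * infsum ?g (U i j)"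
      unfolding B_def
      using infsum_ennreal_append_le[of _ _ ?g 1 ?g ?g, simplified, OF word_weight_append] .
    also have "\<dots> \<le> word_sum S A \<phi> (T - C) i *
        (word_sum S A \<phi> C j * word_sum S A \<phi> (T - C) (n - i - j))"
      unfolding word_sum_def[of S A \<phi> "T - C" i] using U by (rule mult_left_mono) simp
    finally show ?thesis .
  qed
  have "word_sum S A \<phi> T n \<le> infsum ?g (\<Union>p\<in>?I. B (fst p) (snd p))"
    unfolding word_sum_def using cover by (intro infsum_ennreal_mono) blast
  also have "\<dots> \<le> (\<Sum>p\<in>?I. infsum ?g (B (fst p) (snd p)))"
    by (rule infsum_ennreal_UN_le[OF fin])
  also have "\<dots> \<le> (\<Sum>(i, j)\<in>?I.
    word_sum S A \<phi> (T - C) i * (word_sum S A \<phi> C j * word_sum S A \<phi> (T - C) (n - i - j)))"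
    unfolding case_prod_beta by (intro sum_mono B)
  finally show ?thesis .
qed

text \<open>Each of the at most \<open>(n + 1)\<^sup>2\<close> cuts contributes at most a constant times \<open>exp (t n)\<close>; the
  polynomial factor is absorbed by passing from \<open>t\<close> to \<open>s\<close>.\<close>

lemma word_sum_growth_restore_class:
  fixes \<phi> :: "(nat \<Rightarrow> 's) \<Rightarrow> real" and S :: "'s set" and A :: "'s \<Rightarrow> 's \<Rightarrow> nat" and a :: 's
  defines "C \<equiv> comm_class S A a"
  assumes T: "growth_bounded (word_sum S A \<phi> (T - C)) t"
    and C: "growth_bounded (word_sum S A \<phi> C) t" and ts: "t < s"
  shows "growth_bounded (word_sum S A \<phi> T) s"
proof -
  obtain D where D: "D > 0" "\<And>n. word_sum S A \<phi> (T - C) n \<le> ennreal (D * exp (t * real n))"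
    using T unfolding growth_bounded_def by auto
  obtain E where E: "E > 0" "\<And>n. word_sum S A \<phi> C n \<le> ennreal (E * exp (t * real n))"
    using C unfolding growth_bounded_def by auto
  define K where "K = D * (E * D)"
  have K: "K > 0" using D E by (simp add: K_def)
  have bound: "word_sum S A \<phi> T n \<le> ennreal ((real n + 1)\<^sup>2 * K * exp (t * real n))" for n
  proof -
    let ?I = "{(i, j). i + j \<le> n} :: (nat \<times> nat) set"
    have sub: "?I \<subseteq> {..n} \<times> {..n}" by auto
    have "card ?I \<le> card ({..n} \<times> {..n})" using sub by (rule card_mono[rotated]) simp
    then have "real (card ?I) \<le> real ((n + 1) * (n + 1))"
      by (simp only: of_nat_le_iff) (simp add: card_cartesian_product)
    then have card: "real (card ?I) \<le> (real n + 1)\<^sup>2"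
      by (simp add: power2_eq_square algebra_simps)
    have "word_sum S A \<phi> T n \<le> (\<Sum>(i, j)\<in>?I.
        word_sum S A \<phi> (T - C) i * (word_sum S A \<phi> C j * word_sum S A \<phi> (T - C) (n - i - j)))"
      unfolding C_def by (rule word_sum_split_comm_class)
    also have "\<dots> \<le> (\<Sum>p\<in>?I. ennreal (K * exp (t * real n)))"
    proof (rule sum_mono)
      fix p assume "p \<in> ?I"
      then obtain i j where p: "p = (i, j)" "i + j \<le> n" by auto
      then have n: "real n = real i + real j + real (n - i - j)" by linarith
      have "word_sum S A \<phi> (T - C) i * (word_sum S A \<phi> C j * word_sum S A \<phi> (T - C) (n - i - j))
        \<le> ennreal (D * exp (t * real i)) *
          (ennreal (E * exp (t * real j)) * ennreal (D * exp (t * real (n - i - j))))"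
        by (intro mult_mono D E) auto
      also have "\<dots> = ennreal (D * exp (t * real i) *
          (E * exp (t * real j) * (D * exp (t * real (n - i - j)))))"
        using D E by (simp add: ennreal_mult)
      also have "D * exp (t * real i) * (E * exp (t * real j) * (D * exp (t * real (n - i - j))))
          = K * exp (t * real n)"
        by (subst n) (simp only: K_def distrib_left exp_add mult_ac)
      finally show "(case p of (i, j) \<Rightarrow> word_sum S A \<phi> (T - C) i *
          (word_sum S A \<phi> C j * word_sum S A \<phi> (T - C) (n - i - j)))
          \<le> ennreal (K * exp (t * real n))" using p by simp
    qed
    also have "\<dots> = ennreal (real (card ?I) * (K * exp (t * real n)))"
      using K by (simp add: ennreal_mult ennreal_of_nat_eq_real_of_nat)
    also have "\<dots> \<le> ennreal ((real n + 1)\<^sup>2 * (K * exp (t * real n)))"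
      using card K by (intro ennreal_leI mult_right_mono) auto
    finally show ?thesis by (simp add: mult.assoc)
  qed
  define c where "c = (s - t) / 2"
  have c: "c > 0" using ts by (simp add: c_def)
  show ?thesis
  proof (rule growth_boundedI)
    fix n
    \<comment> \<open>Half of \<open>s - t\<close> for each factor \<open>n + 1\<close>, through \<open>x \<le> exp x\<close>.\<close>
    have "c * (real n + 1) \<le> exp (c * (real n + 1))"
      using exp_ge_add_one_self[of "c * (real n + 1)"] by linarith
    then have "(c * (real n + 1))\<^sup>2 \<le> (exp (c * (real n + 1)))\<^sup>2"
      using c by (intro power_mono) auto
    also have "\<dots> = exp ((s - t) * (real n + 1))"
      by (simp add: c_def power2_eq_square flip: exp_add)
    finally have poly: "(real n + 1)\<^sup>2 \<le> exp ((s - t) * (real n + 1)) / c\<^sup>2"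
      using c by (simp add: power_mult_distrib le_divide_eq mult.commute)
    have "(real n + 1)\<^sup>2 * K * exp (t * real n)
        \<le> exp ((s - t) * (real n + 1)) / c\<^sup>2 * K * exp (t * real n)"
      using poly K by (intro mult_right_mono) auto
    also have "exp ((s - t) * (real n + 1)) = exp (s - t) * exp ((s - t) * real n)"
      by (simp add: algebra_simps flip: exp_add)
    also have "exp (s - t) * exp ((s - t) * real n) / c\<^sup>2 * K * exp (t * real n)
        = exp (s - t) / c\<^sup>2 * K * (exp ((s - t) * real n) * exp (t * real n))"
      by simp
    also have "exp ((s - t) * real n) * exp (t * real n) = exp (s * real n)"
      by (simp add: algebra_simps flip: exp_add)
    finally have "ennreal ((real n + 1)\<^sup>2 * K * exp (t * real n))
        \<le> ennreal (exp (s - t) / c\<^sup>2 * K * exp (s * real n))"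
      by (rule ennreal_leI)
    with bound[of n] show "word_sum S A \<phi> T n \<le> ennreal (exp (s - t) / c\<^sup>2 * K * exp (s * real n))"
      by (rule order_trans)
  qed
qed

text \<open>The loop at \<open>a\<close> ensures that any two letters of the class are joined by a path with at least
  one edge, and convexity keeps such a path inside the class.\<close>

lemma irreducible_comm_class:
  assumes loop: "(a, a) \<in> (edges S A)\<^sup>+"
  shows "irreducible_matrix (comm_class S A a) A"
proof -
  let ?C = "comm_class S A a"
  have path: "c \<in> ?C \<longrightarrow> (\<exists>n\<ge>2. \<exists>w\<in>words ?C n. w ! 0 = b \<and> w ! (n - 1) = c
        \<and> (\<forall>i. Suc i < n \<longrightarrow> A (w ! i) (w ! Suc i) = 1))"
    if b: "b \<in> ?C" and "(b, c) \<in> (edges S A)\<^sup>+" for b c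
    using that(2)
  proof (induction rule: trancl_induct)
    case (base c)
    then have "A b c = 1" by (simp add: edges_def)
    then show ?case using b
      by (intro impI exI[of _ 2] conjI bexI[of _ "[b, c]"]) (auto simp: words_def less_Suc_eq)
  next
    case (step d c)
    show ?case
    proof
      assume c: "c \<in> ?C"
      have "d \<in> ?C"
        by (rule comm_class_convex[OF b c]) (use step.hyps in auto)
      with step.IH obtain n w where n: "n \<ge> 2" and w: "w \<in> words ?C n" "w ! 0 = b" "w ! (n - 1) = d"
        "\<And>i. Suc i < n \<Longrightarrow> A (w ! i) (w ! Suc i) = 1" by auto
      have dc: "A d c = 1" using step.hyps by (simp add: edges_def)
      have len: "length w = n" using w(1) by (simp add: words_def)
      have "A ((w @ [c]) ! i) ((w @ [c]) ! Suc i) = 1" if i: "Suc i < Suc n" for i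
      proof (cases "Suc i < n")
        case True
        then show ?thesis using w(4)[of i] len by (simp add: nth_append)
      next
        case False
        then have "i = n - 1" "Suc i = n" using i by auto
        then show ?thesis using w(3) dc len n by (simp add: nth_append)
      qed
      moreover have "w @ [c] \<in> words ?C (Suc n)" using w(1) c by (simp add: words_def)
      moreover have "(w @ [c]) ! 0 = b" "(w @ [c]) ! (Suc n - 1) = c"
        using w(2) len n by (auto simp: nth_append)
      ultimately show "\<exists>n\<ge>2. \<exists>w\<in>words ?C n. w ! 0 = b \<and> w ! (n - 1) = c
        \<and> (\<forall>i. Suc i < n \<longrightarrow> A (w ! i) (w ! Suc i) = 1)"
        using n by (intro exI[of _ "Suc n"]) auto
    qed
  qed
  have "(b, c) \<in> (edges S A)\<^sup>+" if "b \<in> ?C" "c \<in> ?C" for b c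
    using that loop unfolding comm_class_def
    by (auto intro: rtrancl_trancl_trancl trancl_rtrancl_trancl)
  with path show ?thesis unfolding irreducible_matrix_def by blast
qed

text \<open>A point of the full shift that starts with \<open>w\<close> may leave the class after \<open>w\<close>.  As every letter
  of a class with a loop has a successor in the class, the end of \<open>w\<close> can be continued
  differently, by iterating a choice \<open>f\<close> of successors.\<close>

lemma comm_class_cylinder_nonempty:
  assumes loop: "(a, a) \<in> (edges S A)\<^sup>+"
    and w: "w \<in> words (comm_class S A a) n" "n > 0" and ne: "cylinder S A w \<noteq> {}"
  shows "cylinder (comm_class S A a) A w \<noteq> {}"
proof -
  let ?C = "comm_class S A a"
  have "\<exists>c. c \<in> ?C \<and> A b c = 1" if b: "b \<in> ?C" for b
  proof -
    have "(b, b) \<in> (edges S A)\<^sup>+" using b loop unfolding comm_class_def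
      by (auto intro: rtrancl_trancl_trancl trancl_rtrancl_trancl)
    then obtain c where c: "(b, c) \<in> edges S A" "(c, b) \<in> (edges S A)\<^sup>*" by (meson tranclD)
    then have "c \<in> ?C" using comm_class_convex[OF b b] by blast
    then show ?thesis using c by (auto simp: edges_def)
  qed
  then obtain f where f: "\<And>b. b \<in> ?C \<Longrightarrow> f b \<in> ?C \<and> A b (f b) = 1" by metis
  obtain \<upsilon> where \<upsilon>: "\<upsilon> \<in> markov_shift S A" "\<And>i. i < n \<Longrightarrow> \<upsilon> i = w ! i"
    using ne w by (auto simp: cylinder_def words_def)
  have wC: "w ! i \<in> ?C" if "i < n" for i using w that by (auto simp: words_def)
  define \<omega> where "\<omega> = (\<lambda>i. if i < n then w ! i else (f ^^ (Suc i - n)) (w ! (n - 1)))"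
  have fC: "(f ^^ i) (w ! (n - 1)) \<in> ?C" for i
    using f wC[of "n - 1"] w(2) by (induction i) auto
  have "\<omega> i \<in> ?C" for i using wC fC by (simp add: \<omega>_def)
  moreover have "A (\<omega> i) (\<omega> (Suc i)) = 1" for i
  proof -
    consider "Suc i < n" | "Suc i = n" | "n \<le> i" by linarith
    then show ?thesis
    proof cases
      case 1
      then have "\<omega> i = \<upsilon> i" "\<omega> (Suc i) = \<upsilon> (Suc i)" using \<upsilon>(2) by (auto simp: \<omega>_def)
      then show ?thesis using \<upsilon>(1) by (simp add: markov_shift_def)
    next
      case 2
      then have "\<omega> i = w ! (n - 1)" "\<omega> (Suc i) = f (w ! (n - 1))" by (auto simp: \<omega>_def)
      then show ?thesis using f[OF wC[of "n - 1"]] w(2) by simp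
    next
      case 3
      then have "\<omega> (Suc i) = f (\<omega> i)" by (simp add: \<omega>_def Suc_diff_le)
      moreover have "\<omega> i \<in> ?C" using 3 fC[of "Suc i - n"] by (simp add: \<omega>_def del: funpow.simps)
      ultimately show ?thesis using f by simp
    qed
  qed
  ultimately have "\<omega> \<in> cylinder ?C A w"
    using w(1) by (auto simp: cylinder_def markov_shift_def \<omega>_def words_def)
  then show ?thesis by blast
qed

lemma comm_class_submatrix:
  assumes "zero_one_matrix S A" "a \<in> S"
  shows "(comm_class S A a, A) \<in> submatrices S A"
  using assms comm_class_subset[OF assms(2), of A] comm_class_self[of a S A]
  unfolding submatrices_def zero_one_matrix_def by auto

text \<open>On a word \<open>u v\<close> with \<open>v\<close> of length \<open>k\<close>, points \<open>\<omega>\<close> of the full shift are compared with a point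
  \<open>\<upsilon>\<close> of the subsystem along \<open>u\<close> only; along \<open>v\<close> the weight of the full shift is kept, since
  there the variation of \<open>\<phi>\<close> may be infinite.\<close>

lemma comm_class_word_sum_le:
  fixes \<phi> :: "(nat \<Rightarrow> 's) \<Rightarrow> real"
  assumes zo: "zero_one_matrix S A" and a: "a \<in> S" and loop: "(a, a) \<in> (edges S A)\<^sup>+"
    and \<phi>: "\<phi> \<in> F_space \<theta> (markov_shift S A) (k + 1)" and \<theta>: "0 < \<theta>" "\<theta> < 1" and k: "k \<ge> 1"
  defines "C \<equiv> comm_class S A a"
  obtains K where
    "\<And>m. word_sum S A \<phi> C (m + k) \<le> ennreal (exp K) * word_sum C A \<phi> C m * word_sum S A \<phi> C k"
proof -
  obtain K where K: "\<And>m \<omega> \<upsilon>. \<omega> \<in> markov_shift S A \<Longrightarrow> \<upsilon> \<in> markov_shift S A \<Longrightarrow>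
      (\<And>i. i < m + k \<Longrightarrow> \<omega> i = \<upsilon> i) \<Longrightarrow> birkhoff_sum m \<phi> \<omega> \<le> K + birkhoff_sum m \<phi> \<upsilon>"
    using birkhoff_distortion[OF \<phi> \<theta>] by blast
  show ?thesis
  proof (rule that[of K])
    fix m
    have "word_weight S A \<phi> (u @ v) \<le> ennreal (exp K) * word_weight C A \<phi> u * word_weight S A \<phi> v"
      if u: "u \<in> words C m" and v: "v \<in> words C k" for u v
    proof (rule word_weight_leI)
      fix \<omega> assume \<omega>: "\<omega> \<in> cylinder S A (u @ v)"
      have len: "length u = m" "length v = k" using u v by (auto simp: words_def)
      have uv: "u @ v \<in> words C (m + k)" using u v by (auto simp: words_def)
      have "cylinder C A (u @ v) \<noteq> {}"
        unfolding C_def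
        by (rule comm_class_cylinder_nonempty[OF loop uv[unfolded C_def]]) (use k \<omega> in auto)
      then obtain \<upsilon> where \<upsilon>: "\<upsilon> \<in> cylinder C A (u @ v)" by blast
      then have \<upsilon>S: "\<upsilon> \<in> cylinder S A (u @ v)"
        using subsystem_cylinder[OF zo comm_class_submatrix[OF zo a]] unfolding C_def by blast
      have "birkhoff_sum m \<phi> \<omega> \<le> K + birkhoff_sum m \<phi> \<upsilon>"
        using \<omega> \<upsilon>S len by (intro K) (auto simp: cylinder_def)
      then have "exp (birkhoff_sum (m + k) \<phi> \<omega>) \<le>
          exp K * exp (birkhoff_sum m \<phi> \<upsilon>) * exp (birkhoff_sum k \<phi> ((shift ^^ m) \<omega>))"
        by (simp add: birkhoff_sum_add flip: exp_add)
      then have "ennreal (exp (birkhoff_sum (m + k) \<phi> \<omega>)) \<le> ennreal (exp K) *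
          ennreal (exp (birkhoff_sum m \<phi> \<upsilon>)) * ennreal (exp (birkhoff_sum k \<phi> ((shift ^^ m) \<omega>)))"
        by (simp add: ennreal_leI flip: ennreal_mult)
      also have "\<dots> \<le> ennreal (exp K) * word_weight C A \<phi> u * word_weight S A \<phi> v"
        using exp_birkhoff_le_word_weight[OF cylinder_append(1)[OF \<upsilon>], of \<phi>]
          exp_birkhoff_le_word_weight[OF cylinder_append(2)[OF \<omega>], of \<phi>] len
        by (intro mult_mono) auto
      finally show "ennreal (exp (birkhoff_sum (length (u @ v)) \<phi> \<omega>)) \<le>
          ennreal (exp K) * word_weight C A \<phi> u * word_weight S A \<phi> v" using len by simp
    qed
    then show "word_sum S A \<phi> C (m + k) \<le>
        ennreal (exp K) * word_sum C A \<phi> C m * word_sum S A \<phi> C k"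
      unfolding word_sum_def words_add by (rule infsum_ennreal_append_le)
  qed
qed

lemma word_sum_finite:
  assumes "summable_potential S A \<phi>" "T \<subseteq> S"
  shows "word_sum S A \<phi> T n < \<infinity>"
proof -
  have "word_sum S A \<phi> T n \<le> word_sum S A \<phi> S 1 ^ n"
    by (rule order_trans[OF word_sum_mono[OF assms(2)] word_sum_power_le])
  also have "\<dots> < \<infinity>"
    using assms(1) by (simp add: summable_potential_iff power_less_top_ennreal)
  finally show ?thesis .
qed

lemma comm_class_growth:
  fixes \<phi> :: "(nat \<Rightarrow> 's) \<Rightarrow> real"
  assumes zo: "zero_one_matrix S A" and a: "a \<in> S" and loop: "(a, a) \<in> (edges S A)\<^sup>+"
    and \<phi>: "\<phi> \<in> F_space \<theta> (markov_shift S A) (k + 1)" and \<theta>: "0 < \<theta>" "\<theta> < 1" and k: "k \<ge> 1"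
    and summable: "summable_potential S A \<phi>"
    and t: "pressure (comm_class S A a) A \<phi> < ereal t"
  shows "growth_bounded (word_sum S A \<phi> (comm_class S A a)) t"
proof -
  let ?C = "comm_class S A a"
  have fin: "word_sum S A \<phi> ?C n < \<infinity>" for n
    by (rule word_sum_finite[OF summable comm_class_subset[OF a]])
  obtain K where K: "\<And>m. word_sum S A \<phi> ?C (m + k) \<le>
      ennreal (exp K) * word_sum ?C A \<phi> ?C m * word_sum S A \<phi> ?C k"
    using comm_class_word_sum_le[OF zo a loop \<phi> \<theta> k] by blast
  obtain y where y: "word_sum S A \<phi> ?C k = ennreal y" "0 \<le> y"
    using fin[of k] by (cases "word_sum S A \<phi> ?C k") auto
  obtain D where D: "D > 0" "\<And>n. word_sum ?C A \<phi> ?C n \<le> ennreal (D * exp (t * real n))"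
    using pressure_growth(1)[OF subsystem_summable[OF zo comm_class_submatrix[OF zo a] summable] t]
    unfolding growth_bounded_def by auto
  show ?thesis
  proof (rule growth_bounded_offset[OF _ fin])
    fix n
    have "word_sum S A \<phi> ?C (n + k) \<le> ennreal (exp K) * ennreal (D * exp (t * real n)) * ennreal y"
      by (rule order_trans[OF K]) (use D y in \<open>auto intro!: mult_mono\<close>)
    also have "\<dots> = ennreal (exp K * D * y * exp (t * real n))"
      using D y by (simp add: mult_ac flip: ennreal_mult)
    finally show "word_sum S A \<phi> ?C (n + k) \<le> ennreal (exp K * D * y * exp (t * real n))" .
  qed (use D y in auto)
qed

text \<open>Two consecutive letters in the class of \<open>a\<close> would close up to a loop at \<open>a\<close>, so without a loop
  words of length at least \<open>2\<close> have weight \<open>0\<close>.\<close>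

lemma comm_class_growth_no_loop:
  assumes a: "a \<in> S" and no_loop: "(a, a) \<notin> (edges S A)\<^sup>+"
    and summable: "summable_potential S A \<phi>"
  shows "growth_bounded (word_sum S A \<phi> (comm_class S A a)) t"
proof (rule growth_bounded_offset[where k = 2 and D = 0])
  let ?C = "comm_class S A a"
  fix n
  show "word_sum S A \<phi> ?C n < \<infinity>"
    by (rule word_sum_finite[OF summable comm_class_subset[OF a]])
  have "cylinder S A w = {}" if w: "w \<in> words ?C (n + 2)" for w
  proof (rule ccontr)
    assume "cylinder S A w \<noteq> {}"
    then obtain \<omega> where \<omega>: "\<omega> \<in> markov_shift S A" "\<And>i. i < n + 2 \<Longrightarrow> \<omega> i = w ! i"
      using w by (auto simp: cylinder_def words_def)
    have "\<omega> 0 \<in> ?C" "\<omega> 1 \<in> ?C" using w \<omega>(2) by (auto simp: words_def)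
    then have "(a, \<omega> 0) \<in> (edges S A)\<^sup>*" "(\<omega> 1, a) \<in> (edges S A)\<^sup>*" by (auto simp: comm_class_def)
    moreover have "(\<omega> 0, \<omega> 1) \<in> edges S A" using markov_shift_edge[OF \<omega>(1), of 0] by simp
    ultimately have "(a, a) \<in> (edges S A)\<^sup>+"
      by (meson rtrancl_into_trancl1 trancl_rtrancl_trancl)
    with no_loop show False ..
  qed
  then have "word_sum S A \<phi> ?C (n + 2) \<le> infsum (word_weight S A \<phi>) {}"
    unfolding word_sum_def by (intro infsum_ennreal_mono) (auto simp: word_weight_empty_cylinder)
  then show "word_sum S A \<phi> ?C (n + 2) \<le> ennreal (0 * exp (t * real n))" by simp
qed simp

section \<open>Approximation of the pressure\<close>

text \<open>Each restored letter raises the rate a little.  Quantifying over all \<open>s > t\<close> leaves room for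
  finitely many such steps.\<close>

lemma word_sum_growth_finite_restore:
  assumes "finite F" "F \<subseteq> S"
    and class_growth: "\<And>a s. a \<in> F \<Longrightarrow> t < s \<Longrightarrow> growth_bounded (word_sum S A \<phi> (comm_class S A a)) s"
    and "\<And>s. t < s \<Longrightarrow> growth_bounded (word_sum S A \<phi> (T - F)) s" and "t < s"
  shows "growth_bounded (word_sum S A \<phi> T) s"
  using assms
proof (induction F arbitrary: T s rule: finite_induct)
  case empty
  then show ?case by simp
next
  case (insert a F)
  have rest: "growth_bounded (word_sum S A \<phi> (T - {a})) r" if "t < r" for r
  proof (rule insert.IH)
    fix r assume "t < r"
    moreover have "T - {a} - F = T - insert a F" by auto
    ultimately show "growth_bounded (word_sum S A \<phi> (T - {a} - F)) r"
      using insert.prems(3) by simp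
  qed (use insert.prems that in auto)
  obtain r where r: "t < r" "r < s" using insert.prems(4) dense by blast
  show ?case
  proof (rule word_sum_growth_restore_class[OF _ _ r(2)])
    show "growth_bounded (word_sum S A \<phi> (T - comm_class S A a)) r"
      using comm_class_self[of a S A]
      by (intro growth_bounded_mono[OF rest[OF r(1)] word_sum_mono order_refl]) auto
    show "growth_bounded (word_sum S A \<phi> (comm_class S A a)) r"
      using insert.prems(2) r by simp
  qed
qed

theorem theorem2p10:
  fixes S :: "'s set"
    and A :: "'s \<Rightarrow> 's \<Rightarrow> nat"
    and \<theta> :: real
    and k :: nat
    and \<phi> :: "(nat \<Rightarrow> 's) \<Rightarrow> real"
  assumes "countable S"
    and "zero_one_matrix S A"
    and "0 < \<theta>" and "\<theta> < 1"
    and "k \<ge> 1"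
    and "\<phi> \<in> F_space \<theta> (markov_shift S A) (k + 1)"
    and "summable_potential S A \<phi>"
  shows "pressure S A \<phi> =
    (SUP (S\<^sub>0, M) \<in> {(S\<^sub>0, M) \<in> submatrices S A. irreducible_matrix S\<^sub>0 M}. pressure S\<^sub>0 M \<phi>)"
proof (rule antisym)
  let ?Irr = "{(S\<^sub>0, M) \<in> submatrices S A. irreducible_matrix S\<^sub>0 M}"
  let ?P = "SUP (S\<^sub>0, M) \<in> ?Irr. pressure S\<^sub>0 M \<phi>"
  show "?P \<le> pressure S A \<phi>"
    by (rule SUP_least) (auto intro: subsystem_pressure_le assms)
  show "pressure S A \<phi> \<le> ?P"
  proof (rule dense_ge)
    fix x assume "?P < x"
    then obtain s where s: "?P < ereal s" "ereal s < x" using ereal_dense2 by blast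
    \<comment> \<open>The rate \<open>t\<close> is reached outside a finite set; the gap to \<open>s\<close> is spent on restoring its letters.\<close>
    obtain t where t: "?P < ereal t" "t < s" using ereal_dense2[OF s(1)] by auto
    have class_growth: "growth_bounded (word_sum S A \<phi> (comm_class S A a)) r"
      if "a \<in> S" "t < r" for a r
    proof (cases "(a, a) \<in> (edges S A)\<^sup>+")
      case True
      let ?C = "comm_class S A a"
      have "(?C, A) \<in> ?Irr"
        using comm_class_submatrix[OF assms(2) \<open>a \<in> S\<close>] irreducible_comm_class[OF True] by auto
      then have "pressure ?C A \<phi> \<le> ?P" by (rule SUP_upper2) simp
      also have "\<dots> < ereal r" using t(1) \<open>t < r\<close> by (meson ereal_less_eq(3) less_imp_le less_le_trans)
      finally show ?thesis
        by (rule comm_class_growth[OF assms(2) \<open>a \<in> S\<close> True assms(6,3,4,5,7)])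
    next
      case False
      then show ?thesis using comm_class_growth_no_loop[OF \<open>a \<in> S\<close>] assms(7) by blast
    qed
    obtain G where G: "finite G" "G \<subseteq> words S 1"
      "infsum (word_weight S A \<phi>) (words S 1 - G) \<le> ennreal (exp t)"
      using infsum_ennreal_small_tail[of "word_weight S A \<phi>" "words S 1" "ennreal (exp t)"] assms(7)
      unfolding summable_potential_iff word_sum_def by auto
    define F where "F = hd ` G"
    have F: "finite F" "F \<subseteq> S" using G(1,2) unfolding F_def words_1 by auto
    have "words (S - F) 1 \<subseteq> words S 1 - G" unfolding words_1 F_def by force
    then have "word_sum S A \<phi> (S - F) 1 \<le> infsum (word_weight S A \<phi>) (words S 1 - G)"
      unfolding word_sum_def by (intro infsum_ennreal_mono) auto
    with G(3) have tail: "word_sum S A \<phi> (S - F) 1 \<le> ennreal (exp t)" by simp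
    have "growth_bounded (word_sum S A \<phi> (S - F)) t"
    proof (rule growth_boundedI)
      fix n
      have "word_sum S A \<phi> (S - F) n \<le> ennreal (exp t) ^ n"
        by (rule order_trans[OF word_sum_power_le power_mono[OF tail]]) simp
      then show "word_sum S A \<phi> (S - F) n \<le> ennreal (1 * exp (t * real n))"
        by (simp add: ennreal_power mult.commute flip: exp_of_nat_mult)
    qed
    then have "growth_bounded (word_sum S A \<phi> (S - F)) r" if "t < r" for r
      using that growth_bounded_mono less_imp_le by blast
    then have "growth_bounded (word_sum S A \<phi> S) s"
      using word_sum_growth_finite_restore[OF F, of t A \<phi> S s] class_growth F(2) t(2) by blast
    then have "pressure S A \<phi> \<le> ereal s" by (rule pressure_growth(2)[OF assms(7)])
    then show "pressure S A \<phi> \<le> x" using s(2) by simp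
  qed
qed

end
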